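(* Let $I\subseteq\mathbb{R}$ be an open interval, let $a\in I$, and let $K(x,t)=k(x)h(t)$ with $k\in C^1(I)$ and $h\in C(I)$ both zero free (nowhere vanishing on $I$). Define $$D_K:C^1(I)\to C(I),\qquad D_K(f)(x):=\frac{1}{h(x)}\left(\frac{f(x)}{k(x)}\right)'=\frac{k(x)f'(x)-k'(x)f(x)}{h(x)k(x)^2},$$ $$P_K:C(I)\to C^1(I),\qquad P_K(f)(x):=\int_a^x k(x)h(t)f(t)\,dt .$$ Then: (1) for all $f,g\in C^1(I)$, $$D_K(fg)=D_K(f)g+fD_K(g)-D_K(1)fg;$$ (2) for all $f,g\in C(I)$, $$P_K(f)P_K(g)=P_K(fP_K(g))+P_K(P_K(f)g)-P_K\big(D_K(1)P_K(f)P_K(g)\big),$$ and $D_KP_K=\mathrm{id}_{C(I)}$; (3) for all $f,g\in C^1(I)$, $$P_K(D_K(f))P_K(D_K(g))=P_K(D_K(f))g+fP_K(D_K(g))-P_K(D_K(fg))-P_K(D_K(1))\big(fg-P_K(D_K(fg))\big).$$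
   Context: $C(I)$ is the algebra of continuous real-valued functions on $I$ and $C^1(I)$ is the algebra of continuously differentiable real-valued functions on $I$; $1$ denotes the constant function $1$. Products are pointwise. *)

theory Defs
  imports "HOL-Analysis.Analysis"
begin

text \<open>A function on \<open>I\<close> is represented by a total function \<open>real \<Rightarrow> real\<close>, of which only the
  values on \<open>I\<close> matter; equality of functions on \<open>I\<close> is equality at every point of \<open>I\<close>.\<close>

definition C0_on :: "real set \<Rightarrow> (real \<Rightarrow> real) set" where
  "C0_on I = {f. continuous_on I f}"

text \<open>\<^const>\<open>C1_differentiable_on\<close> uses the two-sided derivative, also at points of the boundary of
  the set; for open \<open>I\<close> this is the usual notion.\<close>

definition C1_on :: "real set \<Rightarrow> (real \<Rightarrow> real) set" where
  "C1_on I = {f. f C1_differentiable_on I}"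

definition DK :: "(real \<Rightarrow> real) \<Rightarrow> (real \<Rightarrow> real) \<Rightarrow> (real \<Rightarrow> real) \<Rightarrow> real \<Rightarrow> real" where
  "DK k h f x = 1 / h x * deriv (\<lambda>y. f y / k y) x"

text \<open>The interval integral is oriented, so this covers \<open>x < a\<close> with the usual sign.\<close>

definition PK :: "(real \<Rightarrow> real) \<Rightarrow> (real \<Rightarrow> real) \<Rightarrow> real \<Rightarrow> (real \<Rightarrow> real) \<Rightarrow> real \<Rightarrow> real" where
  "PK k h a f x = (LBINT t=ereal a..ereal x. k x * h t * f t)"

end

theory Submission
  imports Defs
begin

text \<open>Writing \<open>P\<^sub>K f = k \<cdot> \<integral>\<^sub>a h f\<close> and \<open>D\<^sub>K f = (f/k)'/h\<close>, the fundamental theorem of calculus gives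
  \<open>D\<^sub>K P\<^sub>K = id\<close> and \<open>P\<^sub>K D\<^sub>K f = f - (f(a)/k(a)) k\<close>. The product rule for \<open>D\<^sub>K\<close> is the Leibniz rule.
  Applying it to \<open>u = P\<^sub>K f \<cdot> P\<^sub>K g\<close>, which vanishes at \<open>a\<close> so that \<open>u = P\<^sub>K D\<^sub>K u\<close>, yields (2); and (3)
  is an algebraic identity once each \<open>P\<^sub>K D\<^sub>K\<close> has been replaced by its explicit form.\<close>

lemma C1_on_derivD:
  assumes "f \<in> C1_on I" "x \<in> I"
  shows "(f has_real_derivative deriv f x) (at x)"
  using assms unfolding C1_on_def C1_differentiable_on_def mem_Collect_eq
  by (metis DERIV_imp_deriv has_real_derivative_iff_has_vector_derivative)

text \<open>The definition supplies only some continuous derivative \<open>D\<close>; uniqueness of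
  derivatives identifies it with \<open>deriv f\<close> on \<open>I\<close>.\<close>

lemma C1_on_continuous_deriv:
  assumes "f \<in> C1_on I"
  shows "continuous_on I (deriv f)"
proof -
  obtain D where D: "\<And>x. x \<in> I \<Longrightarrow> (f has_real_derivative D x) (at x)" "continuous_on I D"
    using assms unfolding C1_on_def C1_differentiable_on_def mem_Collect_eq
    by (auto simp: has_real_derivative_iff_has_vector_derivative)
  show ?thesis
    using D(2) by (rule continuous_on_eq) (simp add: DERIV_imp_deriv[OF D(1)])
qed

lemma C1_on_continuous:
  assumes "f \<in> C1_on I"
  shows "continuous_on I f"
  using assms C1_differentiable_imp_continuous_on by (auto simp: C1_on_def)

lemma C1_onI:
  assumes "\<And>x. x \<in> I \<Longrightarrow> (f has_real_derivative D x) (at x)" "continuous_on I D"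
  shows "f \<in> C1_on I"
  using assms unfolding C1_on_def C1_differentiable_on_def
  by (auto simp: has_real_derivative_iff_has_vector_derivative)

lemma C1_on_const: "(\<lambda>_. c) \<in> C1_on I"
  by (simp add: C1_on_def)

lemma C1_on_mult:
  assumes "f \<in> C1_on I" "g \<in> C1_on I"
  shows "(\<lambda>x. f x * g x) \<in> C1_on I"
  using assms by (simp add: C1_on_def)

text \<open>The strict margins keep both points interior to a compact segment inside
  \<open>I\<close>, so that derivatives within the segment become two-sided; \<open>a\<close> and
  \<open>b\<close> may come in either order.\<close>

lemma open_interval_enclosing_Icc:
  fixes I :: "real set"
  assumes "open I" "is_interval I" "a \<in> I" "b \<in> I"
  obtains u v where "u < a" "u < b" "a < v" "b < v" "{u..v} \<subseteq> I"
proof -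
  have *: "\<exists>d>0. c - d \<in> I \<and> c + d \<in> I" if "c \<in> I" for c
  proof -
    obtain e where e: "e > 0" "cball c e \<subseteq> I"
      using assms(1) \<open>c \<in> I\<close> by (meson open_contains_cball)
    then have "c - e \<in> I" "c + e \<in> I"
      by (auto intro!: subsetD[OF e(2)] simp: dist_real_def)
    with e(1) show ?thesis
      by (intro exI[of _ e] conjI)
  qed
  from assms(3,4) have "min a b \<in> I" "max a b \<in> I"
    by (auto simp: min_def max_def)
  obtain d where d: "d > 0" "min a b - d \<in> I"
    using *[OF \<open>min a b \<in> I\<close>] by auto
  obtain e where e: "e > 0" "max a b + e \<in> I"
    using *[OF \<open>max a b \<in> I\<close>] by auto
  show ?thesis
  proof
    show "{min a b - d..max a b + e} \<subseteq> I"
      using mem_is_interval_1_I[OF assms(2) d(2) e(2)] by auto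
  qed (use d(1) e(1) in auto)
qed

locale separable_kernel =
  fixes I :: "real set" and a :: real and k h :: "real \<Rightarrow> real"
  assumes open_I: "open I" and interval_I: "is_interval I" and a_in_I: "a \<in> I"
    and k_C1: "k \<in> C1_on I" and h_C0: "continuous_on I h"
    and k_nz: "\<And>x. x \<in> I \<Longrightarrow> k x \<noteq> 0" and h_nz: "\<And>x. x \<in> I \<Longrightarrow> h x \<noteq> 0"
begin

lemma segment_subset:
  assumes "x \<in> I"
  shows "{min a x..max a x} \<subseteq> I"
proof -
  obtain u v where "u < a" "u < x" "a < v" "x < v" "{u..v} \<subseteq> I"
    using open_interval_enclosing_Icc[OF open_I interval_I a_in_I assms] .
  moreover from this have "{min a x..max a x} \<subseteq> {u..v}"
    by auto
  ultimately show ?thesis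
    by blast
qed

text \<open>Constant factors leave the integral unconditionally, so neither integrability of
  \<open>f\<close> nor \<open>x \<in> I\<close> has to be assumed.\<close>

lemma PK_eq: "PK k h a f x = k x * (LBINT t=a..x. h t * f t)"
  unfolding PK_def by (simp add: mult.assoc)

lemma integral_derivative:
  assumes "continuous_on I p" "x \<in> I"
  shows "((\<lambda>x. LBINT t=a..x. p t) has_real_derivative p x) (at x)"
proof -
  obtain u v where uv: "u < a" "u < x" "a < v" "x < v" "{u..v} \<subseteq> I"
    using open_interval_enclosing_Icc[OF open_I interval_I a_in_I assms(2)] .
  have "((\<lambda>x. LBINT t=a..x. p t) has_vector_derivative p x) (at x within {u..v})"
    using uv by (intro interval_integral_FTC2 continuous_on_subset[OF assms(1)]) auto
  \<comment> \<open>The fundamental theorem only gives a derivative within the segment;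
    \<open>x\<close> lies strictly inside it.\<close>
  moreover have "at x within {u..v} = at x"
    using uv by (intro at_within_interior) auto
  ultimately show ?thesis
    by (simp add: has_real_derivative_iff_has_vector_derivative)
qed

lemma integrable_segment:
  assumes "continuous_on I p" "x \<in> I"
  shows "interval_lebesgue_integrable lborel (ereal a) (ereal x) p"
proof (rule interval_integrable_isCont)
  fix t assume "min a x \<le> t" "t \<le> max a x"
  with segment_subset[OF assms(2)] have "t \<in> I"
    by auto
  then show "isCont p t"
    using assms(1) open_I by (simp add: continuous_on_eq_continuous_at)
qed

text \<open>Identities for \<open>DK\<close> are available only at points of \<open>I\<close>; this
  carries them under the integral, whose range from \<open>a\<close> to \<open>x\<close> stays in
  \<open>I\<close>.\<close>

lemma PK_cong:
  assumes "\<And>t. t \<in> I \<Longrightarrow> f t = g t" "x \<in> I"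
  shows "PK k h a f x = PK k h a g x"
  unfolding PK_def
proof (rule interval_integral_cong)
  fix t assume "t \<in> einterval (min (ereal a) (ereal x)) (max (ereal a) (ereal x))"
  then have "t \<in> {min a x..max a x}"
    by (auto simp: einterval_iff min_def max_def split: if_splits)
  then show "k x * h t * f t = k x * h t * g t"
    using segment_subset[OF assms(2)] assms(1) by auto
qed

lemma PK_add:
  assumes "continuous_on I f" "continuous_on I g" "x \<in> I"
  shows "PK k h a (\<lambda>t. f t + g t) x = PK k h a f x + PK k h a g x"
  unfolding PK_eq distrib_left
  by (subst interval_lebesgue_integral_add(2))
    (auto intro!: integrable_segment continuous_intros assms h_C0 simp: distrib_left)

lemma PK_diff:
  assumes "continuous_on I f" "continuous_on I g" "x \<in> I"
  shows "PK k h a (\<lambda>t. f t - g t) x = PK k h a f x - PK k h a g x"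
  unfolding PK_eq right_diff_distrib
  by (subst interval_lebesgue_integral_diff(2))
    (auto intro!: integrable_segment continuous_intros assms h_C0 simp: right_diff_distrib)

lemma PK_derivative:
  assumes "continuous_on I f" "x \<in> I"
  shows "(PK k h a f has_real_derivative
           deriv k x * (LBINT t=a..x. h t * f t) + h x * f x * k x) (at x)"
  unfolding PK_eq
  by (intro DERIV_mult C1_on_derivD[OF k_C1] integral_derivative continuous_intros assms h_C0)

lemma PK_C1:
  assumes "continuous_on I f"
  shows "PK k h a f \<in> C1_on I"
proof (rule C1_onI[OF PK_derivative[OF assms]])
  \<comment> \<open>The primitive occurs in the derivative of \<open>PK k h a f\<close>; it is
    continuous because it is differentiable.\<close>
  have "continuous_on I (\<lambda>x. LBINT t=a..x. h t * f t)"
    using integral_derivative[OF continuous_on_mult[OF h_C0 assms]]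
    by (intro DERIV_continuous_on) (blast intro: has_field_derivative_at_within)
  then show "continuous_on I
      (\<lambda>x. deriv k x * (LBINT t=a..x. h t * f t) + h x * f x * k x)"
    by (intro continuous_intros C1_on_continuous_deriv[OF k_C1] C1_on_continuous[OF k_C1]
        h_C0 assms)
qed

lemma DK_eq:
  assumes "f \<in> C1_on I" "x \<in> I"
  shows "DK k h f x = (k x * deriv f x - deriv k x * f x) / (h x * (k x)^2)"
  unfolding DK_def
  using DERIV_imp_deriv[OF DERIV_divide[OF C1_on_derivD[OF assms]
      C1_on_derivD[OF k_C1 assms(2)] k_nz[OF assms(2)]]]
  by (simp add: power2_eq_square mult.commute)

lemma DK_C0:
  assumes "f \<in> C1_on I"
  shows "continuous_on I (DK k h f)"
proof (rule continuous_on_eq)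
  show "continuous_on I (\<lambda>x. (k x * deriv f x - deriv k x * f x) / (h x * (k x)^2))"
    by (intro continuous_intros C1_on_continuous_deriv C1_on_continuous k_C1 h_C0 assms)
      (auto simp: k_nz h_nz)
qed (simp add: DK_eq assms)

text \<open>The first two terms on the right count
  \<open>- deriv k x * f x * g x / (h x * (k x)^2)\<close> twice, the left side once. Since
  \<open>DK k h (\<lambda>_. 1)\<close> is \<open>- deriv k x / (h x * (k x)^2)\<close>, the last
  term removes the surplus.\<close>

lemma DK_mult:
  assumes "f \<in> C1_on I" "g \<in> C1_on I" "x \<in> I"
  shows "DK k h (\<lambda>y. f y * g y) x
    = DK k h f x * g x + f x * DK k h g x - DK k h (\<lambda>_. 1) x * f x * g x"
proof -
  have "deriv (\<lambda>y. f y * g y) x = deriv f x * g x + deriv g x * f x"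
    using assms by (intro DERIV_imp_deriv DERIV_mult C1_on_derivD)
  then show ?thesis
    using assms k_nz[of x] h_nz[of x]
    by (simp add: DK_eq C1_on_mult C1_on_const field_simps)
qed

text \<open>In the quotient formula the two terms containing \<open>deriv k x\<close> times the
  integral cancel, which leaves \<open>h x * f x * (k x)^2\<close> over the denominator.\<close>

lemma DK_PK:
  assumes "continuous_on I f" "x \<in> I"
  shows "DK k h (PK k h a f) x = f x"
  using assms k_nz[of x] h_nz[of x]
  by (simp add: DK_eq PK_C1 DERIV_imp_deriv[OF PK_derivative] PK_eq field_simps power2_eq_square)

text \<open>The integrand \<open>h t * DK k h f t\<close> is the derivative of
  \<open>f t / k t\<close>; the lower limit contributes the multiple of \<open>k\<close> that is
  subtracted.\<close>

lemma PK_DK: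
  assumes "f \<in> C1_on I" "x \<in> I"
  shows "PK k h a (DK k h f) x = f x - f a / k a * k x"
proof -
  let ?q = "\<lambda>t. f t / k t"
  have der: "(?q has_real_derivative h t * DK k h f t) (at t)" if "t \<in> I" for t
    using DERIV_divide[OF C1_on_derivD[OF assms(1) that] C1_on_derivD[OF k_C1 that] k_nz[OF that]]
      h_nz[OF that]
    by (simp add: DK_eq[OF assms(1) that] power2_eq_square mult.commute)
  have "(LBINT t=a..x. h t * DK k h f t) = ?q x - ?q a"
  proof (rule interval_integral_FTC_finite)
    show "continuous_on {min a x..max a x} (\<lambda>t. h t * DK k h f t)"
      using segment_subset[OF assms(2)]
      by (intro continuous_intros continuous_on_subset[OF h_C0]
          continuous_on_subset[OF DK_C0[OF assms(1)]])
    fix t assume "min a x \<le> t" "t \<le> max a x"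
    then have "t \<in> I"
      using segment_subset[OF assms(2)] by auto
    then show "(?q has_vector_derivative h t * DK k h f t) (at t within {min a x..max a x})"
      using der by (simp add: has_real_derivative_iff_has_vector_derivative
          has_vector_derivative_at_within)
  qed
  then show ?thesis
    using k_nz[OF assms(2)] by (simp add: PK_eq right_diff_distrib)
qed

lemma PK_mult:
  assumes "continuous_on I f" "continuous_on I g" "x \<in> I"
  shows "PK k h a f x * PK k h a g x
    = PK k h a (\<lambda>y. f y * PK k h a g y) x + PK k h a (\<lambda>y. PK k h a f y * g y) x
      - PK k h a (\<lambda>y. DK k h (\<lambda>_. 1) y * PK k h a f y * PK k h a g y) x"
proof -
  let ?u = "\<lambda>y. PK k h a f y * PK k h a g y"
  have C1: "PK k h a f \<in> C1_on I" "PK k h a g \<in> C1_on I"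
    by (intro PK_C1 assms)+
  have "PK k h a f a = 0"
    by (simp add: PK_eq)
  then have "?u x = PK k h a (DK k h ?u) x"
    by (simp add: PK_DK[OF C1_on_mult[OF C1] assms(3)])
  \<comment> \<open>The Leibniz rule for \<open>DK\<close> is applied under the integral, with
    \<open>DK_PK\<close> collapsing the derivatives of both factors to \<open>f\<close> and
    \<open>g\<close>.\<close>
  also have "\<dots> = PK k h a (\<lambda>y. f y * PK k h a g y + PK k h a f y * g y
      - DK k h (\<lambda>_. 1) y * PK k h a f y * PK k h a g y) x"
    by (intro PK_cong assms(3)) (simp add: DK_mult[OF C1] DK_PK assms)
  finally show ?thesis
    by (simp add: PK_add PK_diff continuous_intros assms C1[THEN C1_on_continuous]
        DK_C0[OF C1_on_const])
qed

text \<open>By \<open>PK_DK\<close>, the last bracket is \<open>f a * g a / k a * k x\<close> and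
  its coefficient is \<open>1 - k x / k a\<close>. Their product turns the term linear in
  \<open>k x\<close> into the quadratic one \<open>f a * g a * (k x / k a)^2\<close> of the left
  side.\<close>

lemma PK_DK_mult:
  assumes "f \<in> C1_on I" "g \<in> C1_on I" "x \<in> I"
  shows "PK k h a (DK k h f) x * PK k h a (DK k h g) x
    = PK k h a (DK k h f) x * g x + f x * PK k h a (DK k h g) x
      - PK k h a (DK k h (\<lambda>y. f y * g y)) x
      - PK k h a (DK k h (\<lambda>_. 1)) x * (f x * g x - PK k h a (DK k h (\<lambda>y. f y * g y)) x)"
  using k_nz[OF a_in_I]
  by (simp add: PK_DK[OF _ assms(3)] assms C1_on_mult C1_on_const field_simps)

end

theorem theorem2p8:
  fixes I :: "real set" and a :: real and k h :: "real \<Rightarrow> real"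
  assumes "open I" and "is_interval I" and "a \<in> I"
    and "k \<in> C1_on I" and "h \<in> C0_on I"
    and "\<forall>x\<in>I. k x \<noteq> 0" and "\<forall>x\<in>I. h x \<noteq> 0"
  shows
    \<comment> \<open>\<open>D\<^sub>K\<close> and \<open>P\<^sub>K\<close> map as claimed, and the two expressions for \<open>D\<^sub>K\<close> agree\<close>
    "((\<forall>f\<in>C1_on I. DK k h f \<in> C0_on I \<and>
        (\<forall>x\<in>I. DK k h f x = (k x * deriv f x - deriv k x * f x) / (h x * (k x)^2))) \<and>
     (\<forall>f\<in>C0_on I. PK k h a f \<in> C1_on I))
   \<and>
    (\<forall>f\<in>C1_on I. \<forall>g\<in>C1_on I. \<forall>x\<in>I.
       DK k h (\<lambda>y. f y * g y) x
         = DK k h f x * g x + f x * DK k h g x - DK k h (\<lambda>_. 1) x * f x * g x)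
   \<and>
    ((\<forall>f\<in>C0_on I. \<forall>g\<in>C0_on I. \<forall>x\<in>I.
       PK k h a f x * PK k h a g x
         = PK k h a (\<lambda>y. f y * PK k h a g y) x
           + PK k h a (\<lambda>y. PK k h a f y * g y) x
           - PK k h a (\<lambda>y. DK k h (\<lambda>_. 1) y * PK k h a f y * PK k h a g y) x) \<and>
     (\<forall>f\<in>C0_on I. \<forall>x\<in>I. DK k h (PK k h a f) x = f x))
   \<and>
    (\<forall>f\<in>C1_on I. \<forall>g\<in>C1_on I. \<forall>x\<in>I.
       PK k h a (DK k h f) x * PK k h a (DK k h g) x
         = PK k h a (DK k h f) x * g x + f x * PK k h a (DK k h g) x
           - PK k h a (DK k h (\<lambda>y. f y * g y)) x
           - PK k h a (DK k h (\<lambda>_. 1)) x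
               * (f x * g x - PK k h a (DK k h (\<lambda>y. f y * g y)) x))"
proof -
  interpret separable_kernel I a k h
    using assms by unfold_locales (auto simp: C0_on_def)
  show ?thesis
    unfolding C0_on_def Ball_def mem_Collect_eq
    by (intro conjI allI impI DK_C0 DK_eq PK_C1 DK_mult PK_mult DK_PK PK_DK_mult; assumption)
qed

end
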